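(* Let $n\ge1$, $1\le k\le n$, and let $X_1,\ldots,X_n$ be positive random variables with upper order statistics $X_{1,n}\ge\cdots\ge X_{n,n}$, satisfying $$\lim_{t\to\infty}\frac{\mathbb{P}(X_i>t)}{\mathbb{P}(X_1>t)}=\lambda_i\in[0,\infty)\quad\text{for all } i\in\{1,\ldots,n\},$$ and set $\widetilde\lambda_n=\sum_{i=1}^n\lambda_i$. Let $\mathbf{C}=(C_1,\ldots,C_n)$ be a random vector independent of $(X_1,\ldots,X_n)$ with $C_1>0$, and let $L(\mathbf{C})=\sum_{i=1}^k C_iX_{i,n}$. Suppose that $$\lim_{t\to\infty}\frac{\mathbb{P}(X_1>tx)}{\mathbb{P}(X_1>t)}=x^{-\alpha}\quad\text{for all }x>0,$$ with $\alpha\ge 0$, and $\mathbb{E}[C_1^\beta]<\infty$ for some $\beta\in(\alpha,\infty)$. Suppose $$\lim_{t\to\infty}\max_{1\le i<j\le n}\frac{\mathbb{P}(X_i>t,\ X_j>t)}{\mathbb{P}(X_1>t)}=0,$$ and $\mathbb{E}\big[\max_{2\le i\le n}|C_i|^\gamma\big]\in(0,\infty)$ for some $\gamma\in(\alpha,\infty)$. Then, as $t\to\infty$, $$\mathbb{P}(L(\mathbf{C})>t)\sim\mathbb{P}(C_1X_{1,n}>t)\sim \mathbb{P}(X_1>t)\,\mathbb{E}[C_1^\alpha]\,\widetilde\lambda_n,$$ and moreover $$\mathbb{P}(L(\mathbf{C})>t)\sim\sum_{i=1}^n\mathbb{P}(C_iX_{i,n}>t).$$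
   Context: For positive functions $a,b$, $a(t)\sim c\,b(t)$ means $\lim_{t\to\infty}a(t)/b(t)=c$ for a positive constant $c$. *)

theory Defs
  imports "HOL-Probability.Probability"
begin

definition order_stat :: "nat \<Rightarrow> (nat \<Rightarrow> real) \<Rightarrow> nat \<Rightarrow> real" where
  "order_stat n x i = rev (sort (map x [1..<n+1])) ! (i - 1)"

end

theory Submission
  imports Defs
begin

text \<open>
  With \<open>F(t) = P(X\<^sub>1 > t)\<close>, the Bonferroni inequalities and asymptotic pairwise independence give
  \<open>P(X\<^sub>1\<^sub>,\<^sub>n > t) \<sim> F(t) \<Sum> \<lambda>\<^sub>i\<close>, while \<open>P(X\<^sub>i\<^sub>,\<^sub>n > t) = o(F(t))\<close> for \<open>i \<ge> 2\<close>, since \<open>X\<^sub>i\<^sub>,\<^sub>n\<close> can only be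
  large if two of the variables are. Conditioning on an independent weight \<open>D\<close> with a moment of order
  \<open>\<delta> > \<alpha>\<close> multiplies the limiting constant by \<open>E[D\<^sup>\<alpha>]\<close> (Breiman's lemma): the Potter-type bound
  \<open>F(t / c) \<le> K (1 + c\<^sup>\<delta>) F(t)\<close>, obtained by iterating the halving \<open>t \<mapsto> t / 2\<close>, provides the
  domination. So every term of \<open>L(C)\<close> but the first has a negligible tail, and regular
  variation absorbs the resulting perturbation of the level \<open>t\<close> into a factor \<open>(1 \<plusminus> \<epsilon>)\<^sup>-\<^sup>\<alpha>\<close>.
\<close>

section \<open>Monotone functions, regularly varying tails and Potter's bound\<close>

lemma borel_measurable_antimono:
  fixes H :: "real \<Rightarrow> real"
  assumes "antimono H"
  shows "H \<in> borel_measurable borel"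
proof -
  have "mono (\<lambda>s. - H s)" using assms by (auto simp: mono_def antimono_def)
  then have "(\<lambda>s. - (- H s)) \<in> borel_measurable borel"
    by (intro borel_measurable_uminus borel_measurable_mono)
  then show ?thesis by simp
qed

text \<open>Abstracts the survival function of the reference variable. Positivity at every
  \<open>t\<close> lets quotients by \<open>F t\<close> be cancelled without side
  conditions.\<close>

locale regularly_varying_tail =
  fixes F :: "real \<Rightarrow> real" and \<alpha> :: real
  assumes antimono: "antimono F"
    and pos: "0 < F t"
    and le_1: "F t \<le> 1"
    and index_nonneg: "0 \<le> \<alpha>"
    and scaling: "0 < x \<Longrightarrow> ((\<lambda>t. F (t * x) / F t) \<longlongrightarrow> x powr (-\<alpha>)) at_top"
begin

text \<open>Factor the quotient as \<open>G (t * x) / F (t * x)\<close> times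
  \<open>F (t * x) / F t\<close>; the first factor keeps the limit \<open>c\<close> because
  \<open>t * x\<close> tends to infinity with \<open>t\<close>.\<close>

lemma ratio_scaling:
  assumes lim: "((\<lambda>t. G t / F t) \<longlongrightarrow> c) at_top" and x: "0 < x"
  shows "((\<lambda>t. G (t * x) / F t) \<longlongrightarrow> c * x powr (-\<alpha>)) at_top"
proof -
  have "filterlim (\<lambda>t. t * x) at_top at_top"
    using filterlim_tendsto_pos_mult_at_top[OF tendsto_const x, of "\<lambda>t. t" at_top]
    by (simp add: filterlim_ident mult.commute)
  then have "((\<lambda>t. G (t * x) / F (t * x)) \<longlongrightarrow> c) at_top"
    by (rule filterlim_compose[OF lim])
  from tendsto_mult[OF this scaling[OF x]]
  show ?thesis using pos by (simp add: less_imp_neq[symmetric])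
qed

lemma scaling_divide:
  assumes "0 < c"
  shows "((\<lambda>t. F (t / c) / F t) \<longlongrightarrow> c powr \<alpha>) at_top"
  using scaling[of "1 / c"] assms by (simp add: powr_minus powr_divide)

text \<open>The points \<open>t\<close>, \<open>t / 2\<close>, ..., \<open>t / 2 ^ m\<close> are all
  at least \<open>t0\<close>, so the halving inequality applies \<open>m + 1\<close> times. Only the
  starting point of each halving is constrained: the last value \<open>t / 2 ^ Suc m\<close> may lie
  below \<open>t0\<close>.\<close>

lemma halving_iterate:
  assumes half: "\<And>t. t0 \<le> t \<Longrightarrow> F (t / 2) \<le> B * F t" and B: "0 \<le> B" and t0: "0 < t0"
    and t: "t0 \<le> t / 2 ^ m"
  shows "F (t / 2 ^ Suc m) \<le> B ^ Suc m * F t"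
  using t
proof (induction m)
  case 0
  then show ?case using half[of t] by simp
next
  case (Suc m)
  have "0 < t / 2 ^ Suc m" using Suc.prems t0 by linarith
  then have "t / 2 ^ Suc m \<le> t / 2 ^ m" by (simp add: field_simps)
  then have IH: "F (t / 2 ^ Suc m) \<le> B ^ Suc m * F t"
    using Suc by linarith
  have "F (t / 2 ^ Suc (Suc m)) \<le> B * F (t / 2 ^ Suc m)"
    using half[OF Suc.prems] by (simp add: field_simps)
  also have "\<dots> \<le> B * (B ^ Suc m * F t)"
    using IH B by (intro mult_left_mono)
  finally show ?case by (simp add: mult_ac)
qed

text \<open>Supplies the majorant for dominated convergence. For \<open>c \<le> 1\<close>
  monotonicity suffices, which is what the summand \<open>1\<close> pays for; for larger
  \<open>c\<close> the number of halvings is about \<open>log 2 c\<close>, which produces the power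
  of \<open>c\<close>.\<close>

lemma Potter_bound:
  assumes \<delta>: "\<alpha> < \<delta>"
  obtains K t0 where "0 < K" "0 < t0"
    "\<And>t c. t0 \<le> t \<Longrightarrow> 0 < c \<Longrightarrow> F (t / c) \<le> K * (1 + c powr \<delta>) * F t"
proof -
  \<comment> \<open>The halving ratio tends to \<open>2 powr \<alpha>\<close>, which is strictly
    below \<open>B\<close> because \<open>\<alpha> < \<delta>\<close>.\<close>
  define B where "B = 2 powr \<delta>"
  have "\<forall>\<^sub>F t in at_top. F (t / 2) / F t < B"
    using scaling_divide[of 2] \<delta> by (intro order_tendstoD(2)) (auto simp: B_def)
  then obtain t1 where t1: "\<And>t. t1 \<le> t \<Longrightarrow> F (t / 2) / F t < B"
    by (auto simp: eventually_at_top_linorder)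
  define t0 where "t0 = max t1 1"
  have t0: "0 < t0" by (simp add: t0_def)
  have half: "F (t / 2) \<le> B * F t" if "t0 \<le> t" for t
    using t1[of t] that pos[of t] by (simp add: t0_def field_simps)
  have B: "0 < B" by (simp add: B_def)
  have above: "F (t / c) \<le> B * c powr \<delta> * F t" if tc: "t0 \<le> t / c" and c: "1 \<le> c" for t c
  proof -
    \<comment> \<open>Chosen so that \<open>2 ^ m \<le> c < 2 ^ Suc m\<close>: after
      \<open>m\<close> halvings the level is still at least \<open>t / c\<close>, hence at least
      \<open>t0\<close>, and one more halving passes below \<open>t / c\<close>.\<close>
    define m where "m = nat \<lfloor>log 2 c\<rfloor>"
    have l: "0 \<le> log 2 c" using c by simp
    have "2 powr real m \<le> c"
      using c l by (simp add: m_def powr_le_iff)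
    then have m1: "2 ^ m \<le> c" by (simp add: powr_realpow)
    have "c < 2 powr real (Suc m)"
      using c l by (simp add: m_def less_powr_iff) linarith
    then have m2: "c < 2 ^ Suc m" by (subst (asm) powr_realpow) auto
    have "0 < t / c" using tc t0 by linarith
    then have t: "0 < t" using c by (simp add: zero_less_divide_iff)
    have "F (t / c) \<le> F (t / 2 ^ Suc m)"
      using m2 t c by (intro antimonoD[OF antimono] divide_left_mono) auto
    also have "F (t / 2 ^ Suc m) \<le> B ^ Suc m * F t"
    proof (rule halving_iterate[OF half])
      have "t / c \<le> t / 2 ^ m"
        using m1 t c by (intro divide_left_mono) auto
      then show "t0 \<le> t / 2 ^ m" using tc by linarith
    qed (use B t0 in auto)
    also have "B ^ Suc m = B * (2 ^ m) powr \<delta>"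
      by (simp add: B_def powr_power flip: powr_realpow) (simp add: powr_powr mult.commute)
    also have "\<dots> * F t \<le> B * c powr \<delta> * F t"
      using m1 B pos[of t] \<delta> index_nonneg
      by (intro mult_right_mono mult_left_mono powr_mono2) auto
    finally show ?thesis .
  qed
  \<comment> \<open>The entry \<open>1\<close> serves \<open>c \<le> 1\<close>, and
    \<open>B / F t0\<close> serves levels \<open>t / c\<close> below \<open>t0\<close>. Since
    \<open>F t0 \<le> 1\<close>, the latter also dominates \<open>B\<close>.\<close>
  define K where "K = max 1 (B / F t0)"
  have K: "1 \<le> K" "B / F t0 \<le> K" by (auto simp: K_def)
  have KB: "B \<le> K"
  proof -
    have "B \<le> B / F t0" using B pos[of t0] le_1[of t0] by (simp add: pos_le_divide_eq)
    then show ?thesis using K by linarith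
  qed
  show thesis
  proof (rule that[of K t0])
    show "0 < K" using K by simp
    fix t c :: real
    assume t: "t0 \<le> t" and c: "0 < c"
    consider "c \<le> 1" | "1 \<le> c" "t0 \<le> t / c" | "1 \<le> c" "t / c < t0" by linarith
    then show "F (t / c) \<le> K * (1 + c powr \<delta>) * F t"
    proof cases
      case 1
      have "F (t / c) \<le> F t"
        using 1 c t t0 by (intro antimonoD[OF antimono]) (simp add: field_simps)
      also have "\<dots> \<le> K * (1 + c powr \<delta>) * F t"
      proof -
        have "1 * 1 \<le> K * (1 + c powr \<delta>)" using K by (intro mult_mono) auto
        then show ?thesis using pos[of t] by simp
      qed
      finally show ?thesis .
    next
      case 2
      have "F (t / c) \<le> B * c powr \<delta> * F t" using above 2 by simp
      also have "\<dots> \<le> K * (1 + c powr \<delta>) * F t"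
        using KB B pos[of t] by (intro mult_right_mono mult_mono) auto
      finally show ?thesis .
    next
      case 3
      \<comment> \<open>With \<open>t / t0\<close> in place of \<open>c\<close> the level is exactly
        \<open>t0\<close>, and \<open>t / t0 < c\<close>. This bounds \<open>1\<close> by a multiple
        of \<open>c powr \<delta> * F t\<close>, and \<open>F (t / c)\<close> is at most
        \<open>1\<close>.\<close>
      have "F t0 \<le> B * (t / t0) powr \<delta> * F t"
        using above[of t "t / t0"] t t0 by (simp add: field_simps)
      also have "\<dots> \<le> B * c powr \<delta> * F t"
        using B pos[of t] \<delta> index_nonneg 3 t t0
        by (intro mult_right_mono mult_left_mono powr_mono2) (auto simp: field_simps)
      finally have "1 \<le> (B / F t0) * c powr \<delta> * F t"
        using pos[of t0] by (simp add: field_simps)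
      also have "\<dots> \<le> K * (1 + c powr \<delta>) * F t"
        using K B pos[of t] pos[of t0] by (intro mult_right_mono mult_mono) auto
      finally show ?thesis using le_1[of "t / c"] by linarith
    qed
  qed (use t0 in auto)
qed

text \<open>Breiman's lemma in integral form, with \<open>H\<close> in the role of the tail of the
  other factor. Dominated convergence applies: the pointwise limit comes from regular variation, the
  majorant from Potter's bound. Points with \<open>D \<omega> \<le> 0\<close> contribute
  nothing.\<close>

lemma Breiman_integral:
  fixes H :: "real \<Rightarrow> real" and D :: "'a \<Rightarrow> real"
  assumes "prob_space M"
    and H: "antimono H" "\<And>s. 0 \<le> H s" "\<And>s. H s \<le> 1"
    and lim: "((\<lambda>s. H s / F s) \<longlongrightarrow> h) at_top"
    and D[measurable]: "D \<in> borel_measurable M"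
    and \<delta>: "\<alpha> < \<delta>" and int: "integrable M (\<lambda>\<omega>. D \<omega> powr \<delta>)"
  shows "((\<lambda>t. (\<integral>\<omega>. (if 0 < D \<omega> then H (t / D \<omega>) else 0) \<partial>M) / F t)
           \<longlongrightarrow> h * (\<integral>\<omega>. (if 0 < D \<omega> then D \<omega> powr \<alpha> else 0) \<partial>M)) at_top"
proof -
  interpret prob_space M by fact
  have [measurable]: "H \<in> borel_measurable borel"
    using H(1) by (rule borel_measurable_antimono)
  have "\<forall>\<^sub>F s in at_top. H s / F s < h + 1"
    using lim by (intro order_tendstoD(2)) auto
  then obtain s0 where s0: "\<And>s. s0 \<le> s \<Longrightarrow> H s / F s < h + 1"
    by (auto simp: eventually_at_top_linorder)
  \<comment> \<open>Makes \<open>H s \<le> A * F s\<close> hold for all \<open>s\<close>: beyond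
    \<open>s0\<close> by the limit of the quotient, below \<open>s0\<close> because
    \<open>H s \<le> 1\<close> and \<open>F s \<ge> F s0\<close>.\<close>
  define A where "A = max (h + 1) (1 / F s0)"
  have A: "h + 1 \<le> A" "1 / F s0 \<le> A" "0 < A" using pos[of s0] by (auto simp: A_def less_max_iff_disj)
  have HA: "H s \<le> A * F s" for s
  proof (cases "s0 \<le> s")
    case True
    then have "H s \<le> (h + 1) * F s" using s0[of s] pos[of s] by (simp add: field_simps)
    also have "\<dots> \<le> A * F s" using A pos[of s] by (intro mult_right_mono) auto
    finally show ?thesis .
  next
    case False
    have "1 \<le> A * F s0" using A pos[of s0] by (simp add: field_simps)
    also have "\<dots> \<le> A * F s"
      using A False by (intro mult_left_mono antimonoD[OF antimono]) auto
    finally show ?thesis using H(3)[of s] by linarith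
  qed
  obtain K t0 where K: "0 < K" "0 < t0"
    "\<And>t c. t0 \<le> t \<Longrightarrow> 0 < c \<Longrightarrow> F (t / c) \<le> K * (1 + c powr \<delta>) * F t"
    using Potter_bound[OF \<delta>] by metis
  have "((\<lambda>t. \<integral>\<omega>. (if 0 < D \<omega> then H (t / D \<omega>) else 0) / F t \<partial>M)
           \<longlongrightarrow> (\<integral>\<omega>. h * (if 0 < D \<omega> then D \<omega> powr \<alpha> else 0) \<partial>M)) at_top"
  proof (rule integral_dominated_convergence_at_top[where w = "\<lambda>\<omega>. A * (K * (1 + D \<omega> powr \<delta>))"])
    show "integrable M (\<lambda>\<omega>. A * (K * (1 + D \<omega> powr \<delta>)))" using int by simp
    show "\<forall>\<^sub>F t in at_top. AE \<omega> in M.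
        norm ((if 0 < D \<omega> then H (t / D \<omega>) else 0) / F t) \<le> A * (K * (1 + D \<omega> powr \<delta>))"
      using eventually_ge_at_top[of t0]
    proof eventually_elim
      case (elim t)
      have "(if 0 < D \<omega> then H (t / D \<omega>) else 0) \<le> A * (K * (1 + D \<omega> powr \<delta>)) * F t" for \<omega>
      proof (cases "0 < D \<omega>")
        case True
        have "H (t / D \<omega>) \<le> A * F (t / D \<omega>)" by (rule HA)
        also have "\<dots> \<le> A * (K * (1 + D \<omega> powr \<delta>) * F t)"
          using K(3)[OF elim True] A by (intro mult_left_mono) auto
        finally show ?thesis using True by (simp add: mult_ac)
      qed (use A K pos[of t] in auto)
      then show ?case
        using pos[of t] H(2) by (intro AE_I2) (simp add: pos_divide_le_eq abs_of_pos)
    qed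
    show "AE \<omega> in M. ((\<lambda>t. (if 0 < D \<omega> then H (t / D \<omega>) else 0) / F t)
        \<longlongrightarrow> h * (if 0 < D \<omega> then D \<omega> powr \<alpha> else 0)) at_top"
    proof (intro AE_I2)
      fix \<omega>
      have "((\<lambda>t. H (t / c) / F t) \<longlongrightarrow> h * c powr \<alpha>) at_top" if "0 < c" for c
        using ratio_scaling[OF lim, of "1 / c"] that by (simp add: powr_minus powr_divide)
      then show "((\<lambda>t. (if 0 < D \<omega> then H (t / D \<omega>) else 0) / F t)
        \<longlongrightarrow> h * (if 0 < D \<omega> then D \<omega> powr \<alpha> else 0)) at_top" by simp
    qed
  qed measurable
  then show ?thesis by simp
qed

end

section \<open>Products with an independent weight\<close>

abbreviation (input) tail :: "'a measure \<Rightarrow> ('a \<Rightarrow> real) \<Rightarrow> real \<Rightarrow> real" where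
  "tail M W t \<equiv> measure M {\<omega> \<in> space M. t < W \<omega>}"

lemma (in prob_space) antimono_tail:
  assumes [measurable]: "W \<in> borel_measurable M"
  shows "antimono (tail M W)"
  by (intro antimonoI finite_measure_mono) auto

text \<open>Fubini for the joint law, which is a product by independence. For fixed
  \<open>d > 0\<close> the slice of the event is \<open>w > t / d\<close>; for
  \<open>d \<le> 0\<close> it has probability zero, because \<open>W\<close> is positive and
  \<open>t > 0\<close>.\<close>

lemma (in prob_space) tail_mult_indep:
  fixes W D :: "'a \<Rightarrow> real"
  assumes ind: "indep_var borel W borel D" and W: "\<And>\<omega>. \<omega> \<in> space M \<Longrightarrow> 0 < W \<omega>" and t: "0 < t"
  shows "tail M (\<lambda>\<omega>. D \<omega> * W \<omega>) t = (\<integral>\<omega>. (if 0 < D \<omega> then tail M W (t / D \<omega>) else 0) \<partial>M)"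
proof -
  have [measurable]: "W \<in> borel_measurable M" "D \<in> borel_measurable M"
    using indep_var_rv1[OF ind] indep_var_rv2[OF ind] by auto
  have [measurable]: "tail M W \<in> borel_measurable borel"
    by (intro borel_measurable_antimono antimono_tail) measurable
  let ?W = "distr M borel W" and ?D = "distr M borel D"
  interpret WD: prob_space ?W by (rule prob_space_distr) measurable
  interpret DD: prob_space ?D by (rule prob_space_distr) measurable
  interpret P: pair_prob_space ?W ?D ..
  have eq: "?W \<Otimes>\<^sub>M ?D = distr M (borel \<Otimes>\<^sub>M borel) (\<lambda>\<omega>. (W \<omega>, D \<omega>))"
    using ind by (simp add: indep_var_distribution_eq)
  let ?S = "{p \<in> space (borel \<Otimes>\<^sub>M borel). t < snd p * fst p} :: (real \<times> real) set"
  have S[measurable]: "?S \<in> sets (borel \<Otimes>\<^sub>M borel)" by measurable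
  have sets_eq: "sets (?W \<Otimes>\<^sub>M ?D) = sets (borel \<Otimes>\<^sub>M borel)"
    by (intro sets_pair_measure_cong) auto
  have [measurable]: "(\<lambda>d. emeasure ?W ((\<lambda>w. (w, d)) -` ?S)) \<in> borel_measurable borel"
    using P.measurable_emeasure_Pair2[of ?S] S sets_eq by (simp add: measurable_distr_eq1)
  have slice: "emeasure ?W ((\<lambda>w. (w, D \<omega>)) -` ?S)
      = ennreal (if 0 < D \<omega> then tail M W (t / D \<omega>) else 0)" for \<omega>
  proof -
    have "(\<lambda>w. (w, D \<omega>)) -` ?S = {w. t < D \<omega> * w}" by (auto simp: space_pair_measure)
    then have "emeasure ?W ((\<lambda>w. (w, D \<omega>)) -` ?S) = emeasure M {x\<in>space M. t < D \<omega> * W x}"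
      by (subst emeasure_distr) (auto intro!: arg_cong[where f = "emeasure M"])
    also have "{x\<in>space M. t < D \<omega> * W x} = (if 0 < D \<omega> then {x\<in>space M. t / D \<omega> < W x} else {})"
    proof (cases "0 < D \<omega>")
      case False
      then have "D \<omega> * W x \<le> 0" if "x \<in> space M" for x
        using W[OF that] by (simp add: mult_nonpos_nonneg)
      then show ?thesis using False t by force
    qed (auto simp: field_simps)
    finally show ?thesis by (simp add: emeasure_eq_measure)
  qed
  have "ennreal (tail M (\<lambda>\<omega>. D \<omega> * W \<omega>) t) = emeasure (?W \<Otimes>\<^sub>M ?D) ?S"
    unfolding eq
    by (subst emeasure_distr[OF _ S])
      (auto simp: space_pair_measure emeasure_eq_measure intro!: arg_cong[where f = "measure M"])
  also have "\<dots> = (\<integral>\<^sup>+d. emeasure ?W ((\<lambda>w. (w, d)) -` ?S) \<partial>?D)"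
    using S sets_eq by (intro P.emeasure_pair_measure_alt2) simp
  also have "\<dots> = (\<integral>\<^sup>+\<omega>. emeasure ?W ((\<lambda>w. (w, D \<omega>)) -` ?S) \<partial>M)"
    by (rule nn_integral_distr) auto
  also have "\<dots> = (\<integral>\<^sup>+\<omega>. ennreal (if 0 < D \<omega> then tail M W (t / D \<omega>) else 0) \<partial>M)"
    by (simp only: slice)
  \<comment> \<open>The integrand is bounded by \<open>1\<close>, hence integrable, so both
    integrals agree.\<close>
  also have "\<dots> = ennreal (\<integral>\<omega>. (if 0 < D \<omega> then tail M W (t / D \<omega>) else 0) \<partial>M)"
    by (intro nn_integral_eq_integral integrable_const_bound[where B = 1]) auto
  finally show ?thesis by (simp add: integral_nonneg_AE)
qed

lemma (in regularly_varying_tail) Breiman: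
  fixes W D :: "'a \<Rightarrow> real"
  assumes M: "prob_space M"
    and ind: "prob_space.indep_var M borel W borel D"
    and W: "\<And>\<omega>. \<omega> \<in> space M \<Longrightarrow> 0 < W \<omega>"
    and lim: "((\<lambda>t. tail M W t / F t) \<longlongrightarrow> h) at_top"
    and \<delta>: "\<alpha> < \<delta>" and int: "integrable M (\<lambda>\<omega>. D \<omega> powr \<delta>)"
  shows "((\<lambda>t. tail M (\<lambda>\<omega>. D \<omega> * W \<omega>) t / F t)
           \<longlongrightarrow> h * (\<integral>\<omega>. (if 0 < D \<omega> then D \<omega> powr \<alpha> else 0) \<partial>M)) at_top"
proof -
  interpret prob_space M by fact
  have [measurable]: "W \<in> borel_measurable M" "D \<in> borel_measurable M"
    using indep_var_rv1[OF ind] indep_var_rv2[OF ind] by auto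
  have "((\<lambda>t. (\<integral>\<omega>. (if 0 < D \<omega> then tail M W (t / D \<omega>) else 0) \<partial>M) / F t)
           \<longlongrightarrow> h * (\<integral>\<omega>. (if 0 < D \<omega> then D \<omega> powr \<alpha> else 0) \<partial>M)) at_top"
    by (rule Breiman_integral[OF M antimono_tail _ _ lim _ \<delta> int]) auto
  \<comment> \<open>The integral formula for the tail is available for \<open>t > 0\<close> only,
    which is enough for a limit at infinity.\<close>
  then show ?thesis
    by (rule Lim_transform_eventually)
      (use eventually_gt_at_top[of 0] in eventually_elim, simp add: tail_mult_indep[OF ind W])
qed

section \<open>Order statistics\<close>

lemma sorted_nth_greater_iff:
  fixes t :: "'a :: linorder"
  assumes "sorted_wrt (\<ge>) ys" and "m < length ys"
  shows "t < ys ! m \<longleftrightarrow> m < length (filter (\<lambda>y. t < y) ys)"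
  using assms
proof (induction ys arbitrary: m)
  case (Cons y ys)
  show ?case
  proof (cases "t < y")
    case True
    then show ?thesis using Cons by (cases m) auto
  next
    \<comment> \<open>In a decreasing list the entries above \<open>t\<close> form an initial
      segment, so once the head fails nothing later can exceed \<open>t\<close>.\<close>
    case False
    then have "filter (\<lambda>y. t < y) ys = []"
      using Cons.prems(1) by (force simp: filter_empty_conv)
    moreover have "(y # ys) ! m \<le> y"
      using Cons.prems by (cases m) auto
    ultimately show ?thesis using False by auto
  qed
qed simp

text \<open>Sorting preserves the multiset of values, hence the number of exceedances. This reduces
  all later facts on order statistics to counting; \<open>i - 1\<close> in the definition is the
  zero-based list index.\<close>

lemma order_stat_greater_iff:
  assumes "i \<in> {1..n}"
  shows "t < order_stat n x i \<longleftrightarrow> i \<le> card {j \<in> {1..n}. t < x j}"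
proof -
  let ?ys = "rev (sort (map x [1..<n+1]))"
  have "length (filter (\<lambda>y. t < y) ?ys) = size (filter_mset (\<lambda>y. t < y) (mset ?ys))"
    by (metis mset_filter size_mset)
  also have "\<dots> = length (filter (\<lambda>y. t < y) (map x [1..<n+1]))"
    by (metis mset_filter mset_rev mset_sort size_mset)
  also have "\<dots> = card {j \<in> {1..n}. t < x j}"
    by (auto simp: filter_map comp_def distinct_length_filter intro!: arg_cong[where f = card])
  finally have len: "length (filter (\<lambda>y. t < y) ?ys) = card {j \<in> {1..n}. t < x j}" .
  have "sorted_wrt (\<ge>) ?ys"
    by (simp add: sorted_wrt_rev)
  moreover have "i - 1 < length ?ys" using assms by auto
  ultimately have "t < order_stat n x i \<longleftrightarrow> i - 1 < card {j \<in> {1..n}. t < x j}"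
    unfolding order_stat_def len[symmetric] by (rule sorted_nth_greater_iff)
  then show ?thesis using assms by auto
qed

lemma order_stat_1_greater_iff:
  assumes "1 \<le> n"
  shows "t < order_stat n x 1 \<longleftrightarrow> (\<exists>j\<in>{1..n}. t < x j)"
  using assms by (subst order_stat_greater_iff) (auto simp: Suc_le_eq card_gt_0_iff)

lemma order_stat_2_greaterE:
  assumes "2 \<le> n" "t < order_stat n x 2"
  obtains i j where "1 \<le> i" "i < j" "j \<le> n" "t < x i" "t < x j"
proof -
  have "2 \<le> card {j \<in> {1..n}. t < x j}"
    using assms by (simp add: order_stat_greater_iff)
  then have "\<not> card {j \<in> {1..n}. t < x j} \<le> Suc 0" by simp
  then obtain i j where "i \<in> {1..n}" "t < x i" "j \<in> {1..n}" "t < x j" "i \<noteq> j"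
    by (subst (asm) card_le_Suc0_iff_eq) auto
  then show thesis using that[of i j] that[of j i] by (cases i j rule: linorder_cases) auto
qed

text \<open>Take the supposedly smaller value, that of rank \<open>i\<close>, as threshold: at least
  \<open>j\<close>, hence at least \<open>i\<close>, entries would exceed it, so it would exceed
  itself.\<close>

lemma order_stat_antimono:
  assumes "1 \<le> i" "i \<le> j" "j \<le> n"
  shows "order_stat n x j \<le> order_stat n x i"
proof (rule ccontr)
  assume "\<not> ?thesis"
  then have "order_stat n x i < order_stat n x j" by simp
  then have "j \<le> card {l \<in> {1..n}. order_stat n x i < x l}"
    using assms order_stat_greater_iff[of j n "order_stat n x i" x] by simp
  then have "order_stat n x i < order_stat n x i"
    using assms order_stat_greater_iff[of i n "order_stat n x i" x] by simp
  then show False by simp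
qed

lemma order_stat_pos:
  assumes "i \<in> {1..n}" "\<And>j. j \<in> {1..n} \<Longrightarrow> 0 < x j"
  shows "0 < order_stat n x i"
proof -
  have "{j \<in> {1..n}. 0 < x j} = {1..n}" using assms by auto
  then show ?thesis using assms(1) by (simp add: order_stat_greater_iff)
qed

lemma order_stat_cong:
  assumes "\<And>j. j \<in> {1..n} \<Longrightarrow> x j = y j"
  shows "order_stat n x i = order_stat n y i"
proof -
  have "map x [1..<n+1] = map y [1..<n+1]" using assms by (intro map_cong) auto
  then show ?thesis by (simp only: order_stat_def)
qed

lemma borel_measurable_order_stat:
  assumes i: "i \<in> {1..n}" and X: "\<And>j. j \<in> {1..n} \<Longrightarrow> X j \<in> borel_measurable M"
  shows "(\<lambda>\<omega>. order_stat n (\<lambda>j. X j \<omega>) i) \<in> borel_measurable M"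
  unfolding borel_measurable_iff_greater
proof
  fix t
  \<comment> \<open>The number of exceedances is a finite sum of indicators, hence measurable in
    \<open>\<omega>\<close>.\<close>
  have "{\<omega> \<in> space M. t < order_stat n (\<lambda>j. X j \<omega>) i}
      = {\<omega> \<in> space M. real i \<le> (\<Sum>j\<in>{1..n}. if t < X j \<omega> then 1 else 0)}"
  proof -
    have eq: "(\<Sum>j\<in>{1..n}. if t < X j \<omega> then 1 else 0) = real (card {j \<in> {1..n}. t < X j \<omega>})" for \<omega>
      by (simp add: sum.If_cases Int_def)
    show ?thesis unfolding order_stat_greater_iff[OF i] eq by simp
  qed
  also have "\<dots> \<in> sets M"
  proof -
    have [measurable]: "(\<lambda>\<omega>. \<Sum>j\<in>{1..n}. if t < X j \<omega> then 1 else (0::real)) \<in> borel_measurable M"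
      using X by (intro borel_measurable_sum measurable_If borel_measurable_const) auto
    show ?thesis by measurable
  qed
  finally show "{\<omega> \<in> space M. t < order_stat n (\<lambda>j. X j \<omega>) i} \<in> sets M" .
qed

text \<open>Both variables are measurable functions of the two independent vectors. The function
  \<open>g\<close> covers a weight as well as its absolute value.\<close>

lemma (in prob_space) indep_var_order_stat_component:
  assumes indep: "indep_var (PiM {1..n} (\<lambda>_. borel)) (\<lambda>\<omega>. \<lambda>i\<in>{1..n}. X i \<omega>)
                    (PiM {1..n} (\<lambda>_. borel)) (\<lambda>\<omega>. \<lambda>i\<in>{1..n}. C i \<omega>)"
    and i: "i \<in> {1..n}" and l: "l \<in> {1..n}" and g: "g \<in> borel_measurable borel"
  shows "indep_var borel (\<lambda>\<omega>. order_stat n (\<lambda>j. X j \<omega>) i) borel (\<lambda>\<omega>. g (C l \<omega>) :: real)"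
proof -
  have 1: "(\<lambda>x. order_stat n (\<lambda>j. x j) i) \<in> borel_measurable (PiM {1..n} (\<lambda>_. borel))"
    by (rule borel_measurable_order_stat[OF i]) measurable
  have 2: "(\<lambda>c. g (c l)) \<in> borel_measurable (PiM {1..n} (\<lambda>_. borel))"
    using g l by measurable
  have "indep_var borel ((\<lambda>x. order_stat n (\<lambda>j. x j) i) \<circ> (\<lambda>\<omega>. \<lambda>i\<in>{1..n}. X i \<omega>))
                  borel ((\<lambda>c. g (c l)) \<circ> (\<lambda>\<omega>. \<lambda>i\<in>{1..n}. C i \<omega>))"
    by (rule indep_var_compose[OF indep 1 2])
  also have "(\<lambda>x. order_stat n (\<lambda>j. x j) i) \<circ> (\<lambda>\<omega>. \<lambda>i\<in>{1..n}. X i \<omega>)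
      = (\<lambda>\<omega>. order_stat n (\<lambda>j. X j \<omega>) i)"
    by (rule ext) (auto simp: comp_def intro!: order_stat_cong)
  also have "(\<lambda>c. g (c l)) \<circ> (\<lambda>\<omega>. \<lambda>i\<in>{1..n}. C i \<omega>) = (\<lambda>\<omega>. g (C l \<omega>))"
    using l by (simp add: comp_def)
  finally show ?thesis .
qed

section \<open>Negligible sums and perturbations\<close>

context regularly_varying_tail
begin

text \<open>If a sum exceeds \<open>t\<close>, some summand exceeds a fixed fraction of
  \<open>t\<close>; regular variation makes the change of level cost only a constant factor.\<close>

lemma tail_sum_negligible:
  assumes "prob_space M" "finite I"
    and meas: "\<And>i. i \<in> I \<Longrightarrow> R i \<in> borel_measurable M"
    and lim: "\<And>i. i \<in> I \<Longrightarrow> ((\<lambda>t. tail M (R i) t / F t) \<longlongrightarrow> 0) at_top"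
  shows "((\<lambda>t. tail M (\<lambda>\<omega>. \<Sum>i\<in>I. R i \<omega>) t / F t) \<longlongrightarrow> 0) at_top"
proof -
  interpret prob_space M by fact
  \<comment> \<open>The \<open>+ 1\<close> keeps the denominator positive for empty
    \<open>I\<close>.\<close>
  define N where "N = 1 / real (card I + 1)"
  have N: "0 < N" by (simp add: N_def)
  have le: "tail M (\<lambda>\<omega>. \<Sum>i\<in>I. R i \<omega>) t \<le> (\<Sum>i\<in>I. tail M (R i) (t * N))" if t: "0 < t" for t
  proof -
    have "{\<omega> \<in> space M. t < (\<Sum>i\<in>I. R i \<omega>)} \<subseteq> (\<Union>i\<in>I. {\<omega> \<in> space M. t * N < R i \<omega>})"
    proof
      fix \<omega> assume \<omega>: "\<omega> \<in> {\<omega> \<in> space M. t < (\<Sum>i\<in>I. R i \<omega>)}"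
      show "\<omega> \<in> (\<Union>i\<in>I. {\<omega> \<in> space M. t * N < R i \<omega>})"
      proof (rule ccontr)
        assume "\<not> ?thesis"
        then have "R i \<omega> \<le> t * N" if "i \<in> I" for i using that \<omega> by force
        then have "(\<Sum>i\<in>I. R i \<omega>) \<le> real (card I) * (t * N)"
          by (rule sum_bounded_above)
        also have "\<dots> \<le> t" using t by (simp add: N_def field_simps)
        finally show False using \<omega> by simp
      qed
    qed
    then have "tail M (\<lambda>\<omega>. \<Sum>i\<in>I. R i \<omega>) t \<le> measure M (\<Union>i\<in>I. {\<omega> \<in> space M. t * N < R i \<omega>})"
      using meas \<open>finite I\<close> by (intro finite_measure_mono sets.finite_UN) auto
    also have "\<dots> \<le> (\<Sum>i\<in>I. tail M (R i) (t * N))"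
      using meas \<open>finite I\<close> by (intro measure_UNION_le) auto
    finally show ?thesis .
  qed
  have "((\<lambda>t. \<Sum>i\<in>I. tail M (R i) (t * N) / F t) \<longlongrightarrow> (\<Sum>i\<in>I. 0 * N powr (-\<alpha>))) at_top"
    using lim N by (intro tendsto_sum ratio_scaling)
  then have ub: "((\<lambda>t. (\<Sum>i\<in>I. tail M (R i) (t * N)) / F t) \<longlongrightarrow> 0) at_top"
    by (simp add: sum_divide_distrib)
  show ?thesis
  proof (rule tendsto_sandwich[OF _ _ tendsto_const ub])
    show "\<forall>\<^sub>F t in at_top. tail M (\<lambda>\<omega>. \<Sum>i\<in>I. R i \<omega>) t / F t \<le> (\<Sum>i\<in>I. tail M (R i) (t * N)) / F t"
      using eventually_gt_at_top[of 0]
      by eventually_elim (rule divide_right_mono[OF le less_imp_le[OF pos]])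
  qed (use pos in \<open>auto intro!: always_eventually divide_nonneg_pos\<close>)
qed

text \<open>If \<open>L\<close> exceeds \<open>t\<close>, then \<open>U\<close> exceeds
  \<open>t * (1 - e)\<close> or \<open>R\<close> exceeds \<open>t * e\<close>; if \<open>U\<close>
  exceeds \<open>t * (1 + e)\<close>, then \<open>L\<close> exceeds \<open>t\<close> or
  \<open>R\<close> exceeds \<open>t * e\<close>. The terms in \<open>R\<close> vanish in the limit
  for fixed \<open>e\<close>, and \<open>e\<close> is arbitrarily small.\<close>

lemma tail_perturbation:
  assumes "prob_space M"
    and [measurable]: "U \<in> borel_measurable M" "L \<in> borel_measurable M" "R \<in> borel_measurable M"
    and close: "\<And>\<omega>. \<omega> \<in> space M \<Longrightarrow> \<bar>L \<omega> - U \<omega>\<bar> \<le> R \<omega>"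
    and U: "((\<lambda>t. tail M U t / F t) \<longlongrightarrow> c) at_top"
    and R: "((\<lambda>t. tail M R t / F t) \<longlongrightarrow> 0) at_top"
  shows "((\<lambda>t. tail M L t / F t) \<longlongrightarrow> c) at_top"
proof -
  interpret prob_space M by fact
  have upper: "tail M L t \<le> tail M U (t * (1 - e)) + tail M R (t * e)" for t e
  proof -
    have "{\<omega> \<in> space M. t < L \<omega>} \<subseteq> {\<omega> \<in> space M. t * (1 - e) < U \<omega>} \<union> {\<omega> \<in> space M. t * e < R \<omega>}"
      using close by (auto simp: algebra_simps) (smt (verit))
    then have "tail M L t \<le> measure M ({\<omega> \<in> space M. t * (1 - e) < U \<omega>} \<union> {\<omega> \<in> space M. t * e < R \<omega>})"
      by (intro finite_measure_mono) auto
    also have "\<dots> \<le> tail M U (t * (1 - e)) + tail M R (t * e)"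
      by (intro measure_Un_le) auto
    finally show ?thesis .
  qed
  have lower: "tail M U (t * (1 + e)) \<le> tail M L t + tail M R (t * e)" for t e
  proof -
    have "{\<omega> \<in> space M. t * (1 + e) < U \<omega>} \<subseteq> {\<omega> \<in> space M. t < L \<omega>} \<union> {\<omega> \<in> space M. t * e < R \<omega>}"
      using close by (auto simp: algebra_simps) (smt (verit))
    then have "tail M U (t * (1 + e)) \<le> measure M ({\<omega> \<in> space M. t < L \<omega>} \<union> {\<omega> \<in> space M. t * e < R \<omega>})"
      by (intro finite_measure_mono) auto
    also have "\<dots> \<le> tail M L t + tail M R (t * e)"
      by (intro measure_Un_le) auto
    finally show ?thesis .
  qed
  show ?thesis
  proof (rule order_tendstoI)
    fix a assume a: "c < a"
    \<comment> \<open>By continuity at \<open>0\<close>, some \<open>e\<close> in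
      \<open>(0, 1)\<close> brings the limiting upper bound below \<open>a\<close>; \<open>e\<close>
      is fixed before \<open>t\<close> grows. The lower bound is symmetric.\<close>
    have "((\<lambda>e. c * (1 - e) powr (-\<alpha>)) \<longlongrightarrow> c * (1 - 0) powr (-\<alpha>)) (at_right (0::real))"
      by (intro tendsto_intros) auto
    then have "\<forall>\<^sub>F e in at_right 0. c * (1 - e) powr (-\<alpha>) < a"
      using a by (intro order_tendstoD(2)) auto
    moreover have "\<forall>\<^sub>F e in at_right (0::real). 0 < e \<and> e < 1"
      using eventually_at_right_real[of 0 1] by simp
    ultimately have "\<forall>\<^sub>F e in at_right 0. c * (1 - e) powr (-\<alpha>) < a \<and> 0 < e \<and> e < 1"
      by eventually_elim simp
    then obtain e where e: "c * (1 - e) powr (-\<alpha>) < a" "0 < e" "e < 1"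
      using eventually_happens[of _ "at_right (0::real)"] by auto
    have "((\<lambda>t. tail M U (t * (1 - e)) / F t + tail M R (t * e) / F t)
        \<longlongrightarrow> c * (1 - e) powr (-\<alpha>) + 0 * e powr (-\<alpha>)) at_top"
      using e by (intro tendsto_add ratio_scaling U R) auto
    then have "\<forall>\<^sub>F t in at_top. tail M U (t * (1 - e)) / F t + tail M R (t * e) / F t < a"
      using e by (intro order_tendstoD(2)) auto
    then show "\<forall>\<^sub>F t in at_top. tail M L t / F t < a"
    proof eventually_elim
      case (elim t)
      have "tail M L t / F t \<le> (tail M U (t * (1 - e)) + tail M R (t * e)) / F t"
        using upper pos[of t] by (intro divide_right_mono) auto
      then show ?case using elim by (simp add: add_divide_distrib)
    qed
  next
    fix a assume a: "a < c"
    have "((\<lambda>e. c * (1 + e) powr (-\<alpha>)) \<longlongrightarrow> c * (1 + 0) powr (-\<alpha>)) (at_right (0::real))"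
      by (intro tendsto_intros) auto
    then have "\<forall>\<^sub>F e in at_right 0. a < c * (1 + e) powr (-\<alpha>)"
      using a by (intro order_tendstoD(1)) auto
    moreover have "\<forall>\<^sub>F e in at_right (0::real). 0 < e \<and> e < 1"
      using eventually_at_right_real[of 0 1] by simp
    ultimately have "\<forall>\<^sub>F e in at_right 0. a < c * (1 + e) powr (-\<alpha>) \<and> 0 < e \<and> e < 1"
      by eventually_elim simp
    then obtain e where e: "a < c * (1 + e) powr (-\<alpha>)" "0 < e" "e < 1"
      using eventually_happens[of _ "at_right (0::real)"] by auto
    have "((\<lambda>t. tail M U (t * (1 + e)) / F t - tail M R (t * e) / F t)
        \<longlongrightarrow> c * (1 + e) powr (-\<alpha>) - 0 * e powr (-\<alpha>)) at_top"
      using e by (intro tendsto_diff ratio_scaling U R) auto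
    then have "\<forall>\<^sub>F t in at_top. a < tail M U (t * (1 + e)) / F t - tail M R (t * e) / F t"
      using e by (intro order_tendstoD(1)) auto
    then show "\<forall>\<^sub>F t in at_top. a < tail M L t / F t"
    proof eventually_elim
      case (elim t)
      have "tail M U (t * (1 + e)) / F t \<le> (tail M L t + tail M R (t * e)) / F t"
        using lower pos[of t] by (intro divide_right_mono) auto
      then show ?case using elim by (simp add: add_divide_distrib)
    qed
  qed
qed

end

text \<open>The parts \<open>B i\<close> of \<open>A i\<close> outside all other sets are disjoint,
  and each loses at most its pairwise overlaps. Every unordered pair is subtracted twice, which is
  harmless when overlaps are negligible.\<close>

lemma (in finite_measure) measure_UN_ge_Bonferroni:
  assumes "finite I" and A: "\<And>i. i \<in> I \<Longrightarrow> A i \<in> sets M"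
  shows "(\<Sum>i\<in>I. measure M (A i)) - (\<Sum>i\<in>I. \<Sum>j\<in>I - {i}. measure M (A i \<inter> A j))
         \<le> measure M (\<Union>i\<in>I. A i)"
proof -
  define B where "B i = A i - (\<Union>j\<in>I - {i}. A i \<inter> A j)" for i
  have UN: "(\<Union>j\<in>I - {i}. A i \<inter> A j) \<in> sets M" if "i \<in> I" for i
    using that assms by (intro sets.finite_UN sets.Int) auto
  have B: "B i \<in> sets M" if "i \<in> I" for i
    unfolding B_def using that A UN by (intro sets.Diff) auto
  have "measure M (A i) - (\<Sum>j\<in>I - {i}. measure M (A i \<inter> A j)) \<le> measure M (B i)" if "i \<in> I" for i
  proof -
    have "measure M (B i) = measure M (A i) - measure M (\<Union>j\<in>I - {i}. A i \<inter> A j)"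
      unfolding B_def using that A UN by (intro finite_measure_Diff) auto
    moreover have "measure M (\<Union>j\<in>I - {i}. A i \<inter> A j) \<le> (\<Sum>j\<in>I - {i}. measure M (A i \<inter> A j))"
      using that assms by (intro measure_UNION_le sets.Int) auto
    ultimately show ?thesis by simp
  qed
  then have "(\<Sum>i\<in>I. measure M (A i) - (\<Sum>j\<in>I - {i}. measure M (A i \<inter> A j))) \<le> (\<Sum>i\<in>I. measure M (B i))"
    by (rule sum_mono)
  also have "\<dots> = measure M (\<Union>i\<in>I. B i)"
    using assms B by (intro finite_measure_finite_Union[symmetric])
      (auto simp: disjoint_family_on_def B_def)
  also have "\<dots> \<le> measure M (\<Union>i\<in>I. A i)"
    using assms by (intro finite_measure_mono sets.finite_UN) (auto simp: B_def)
  finally show ?thesis by (simp add: sum_subtractf)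
qed

section \<open>Tails of the order statistics\<close>

context regularly_varying_tail
begin

text \<open>The maximum exceeds \<open>t\<close> exactly on the union of the events for the single
  variables. The union bound gives the upper estimate, and Bonferroni gives the lower one up to
  vanishing pair terms.\<close>

lemma tail_order_stat_1:
  assumes "prob_space M" "1 \<le> n"
    and X: "\<And>i. i \<in> {1..n} \<Longrightarrow> X i \<in> borel_measurable M"
    and lam: "\<And>i. i \<in> {1..n} \<Longrightarrow> ((\<lambda>t. tail M (X i) t / F t) \<longlongrightarrow> lam i) at_top"
    and pair: "\<And>i j. i \<in> {1..n} \<Longrightarrow> j \<in> {1..n} \<Longrightarrow> i \<noteq> j \<Longrightarrow>
      ((\<lambda>t. measure M {\<omega> \<in> space M. t < X i \<omega> \<and> t < X j \<omega>} / F t) \<longlongrightarrow> 0) at_top"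
  shows "((\<lambda>t. tail M (\<lambda>\<omega>. order_stat n (\<lambda>j. X j \<omega>) 1) t / F t) \<longlongrightarrow> (\<Sum>i=1..n. lam i)) at_top"
proof -
  interpret prob_space M by fact
  let ?A = "\<lambda>t i. {\<omega> \<in> space M. t < X i \<omega>}"
  let ?q = "\<lambda>t i j. measure M {\<omega> \<in> space M. t < X i \<omega> \<and> t < X j \<omega>}"
  have A: "?A t i \<in> sets M" if "i \<in> {1..n}" for t i using X[OF that] by measurable
  have max_eq: "{\<omega> \<in> space M. t < order_stat n (\<lambda>j. X j \<omega>) 1} = (\<Union>i\<in>{1..n}. ?A t i)" for t
    using order_stat_1_greater_iff[OF \<open>1 \<le> n\<close>] by auto
  have Int: "?A t i \<inter> ?A t j = {\<omega> \<in> space M. t < X i \<omega> \<and> t < X j \<omega>}" for t i j by auto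
  have ub: "((\<lambda>t. \<Sum>i=1..n. tail M (X i) t / F t) \<longlongrightarrow> (\<Sum>i=1..n. lam i)) at_top"
    by (intro tendsto_sum lam)
  have "((\<lambda>t. (\<Sum>i=1..n. tail M (X i) t / F t) - (\<Sum>i=1..n. \<Sum>j\<in>{1..n} - {i}. ?q t i j / F t))
      \<longlongrightarrow> (\<Sum>i=1..n. lam i) - (\<Sum>i=1..n. \<Sum>j\<in>{1..n} - {i}. 0)) at_top"
    by (intro tendsto_diff tendsto_sum lam pair) auto
  then have lb: "((\<lambda>t. (\<Sum>i=1..n. tail M (X i) t / F t) - (\<Sum>i=1..n. \<Sum>j\<in>{1..n} - {i}. ?q t i j / F t))
      \<longlongrightarrow> (\<Sum>i=1..n. lam i)) at_top" by simp
  show ?thesis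
  proof (rule tendsto_sandwich[OF _ _ lb ub])
    show "\<forall>\<^sub>F t in at_top. (\<Sum>i=1..n. tail M (X i) t / F t) - (\<Sum>i=1..n. \<Sum>j\<in>{1..n} - {i}. ?q t i j / F t)
        \<le> tail M (\<lambda>\<omega>. order_stat n (\<lambda>j. X j \<omega>) 1) t / F t"
    proof (rule always_eventually, rule allI)
      fix t
      have "((\<Sum>i=1..n. tail M (X i) t) - (\<Sum>i=1..n. \<Sum>j\<in>{1..n} - {i}. ?q t i j)) / F t
          \<le> tail M (\<lambda>\<omega>. order_stat n (\<lambda>j. X j \<omega>) 1) t / F t"
        unfolding max_eq using measure_UN_ge_Bonferroni[of "{1..n}" "?A t"] A pos[of t]
        by (intro divide_right_mono) (auto simp: Int)
      then show "(\<Sum>i=1..n. tail M (X i) t / F t) - (\<Sum>i=1..n. \<Sum>j\<in>{1..n} - {i}. ?q t i j / F t)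
        \<le> tail M (\<lambda>\<omega>. order_stat n (\<lambda>j. X j \<omega>) 1) t / F t"
        by (simp only: diff_divide_distrib sum_divide_distrib)
    qed
    show "\<forall>\<^sub>F t in at_top. tail M (\<lambda>\<omega>. order_stat n (\<lambda>j. X j \<omega>) 1) t / F t
        \<le> (\<Sum>i=1..n. tail M (X i) t / F t)"
    proof (rule always_eventually, rule allI)
      fix t
      have "tail M (\<lambda>\<omega>. order_stat n (\<lambda>j. X j \<omega>) 1) t / F t \<le> (\<Sum>i=1..n. tail M (X i) t) / F t"
        unfolding max_eq using A pos[of t] by (intro divide_right_mono measure_UNION_le) auto
      then show "tail M (\<lambda>\<omega>. order_stat n (\<lambda>j. X j \<omega>) 1) t / F t \<le> (\<Sum>i=1..n. tail M (X i) t / F t)"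
        by (simp only: sum_divide_distrib)
    qed
  qed
qed

text \<open>An order statistic of rank at least two lies below the second one, so its exceedance
  forces two distinct variables above \<open>t\<close>; finitely many pairs remain to be
  summed.\<close>

lemma tail_order_stat_negligible:
  assumes "prob_space M" and l: "l \<in> {2..n}"
    and X: "\<And>i. i \<in> {1..n} \<Longrightarrow> X i \<in> borel_measurable M"
    and pair: "\<And>i j. i \<in> {1..n} \<Longrightarrow> j \<in> {1..n} \<Longrightarrow> i \<noteq> j \<Longrightarrow>
      ((\<lambda>t. measure M {\<omega> \<in> space M. t < X i \<omega> \<and> t < X j \<omega>} / F t) \<longlongrightarrow> 0) at_top"
  shows "((\<lambda>t. tail M (\<lambda>\<omega>. order_stat n (\<lambda>j. X j \<omega>) l) t / F t) \<longlongrightarrow> 0) at_top"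
proof -
  interpret prob_space M by fact
  let ?I = "SIGMA i:{1..n}. {1..n} - {i}"
  let ?B = "\<lambda>t p. {\<omega> \<in> space M. t < X (fst p) \<omega> \<and> t < X (snd p) \<omega>}"
  have B: "?B t p \<in> sets M" if "p \<in> ?I" for t p
  proof -
    have [measurable]: "X (fst p) \<in> borel_measurable M" "X (snd p) \<in> borel_measurable M"
      using that X by auto
    show ?thesis by measurable
  qed
  have le: "tail M (\<lambda>\<omega>. order_stat n (\<lambda>j. X j \<omega>) l) t / F t \<le> (\<Sum>p\<in>?I. measure M (?B t p) / F t)" for t
  proof -
    have "{\<omega> \<in> space M. t < order_stat n (\<lambda>j. X j \<omega>) l} \<subseteq> (\<Union>p\<in>?I. ?B t p)"
    proof safe
      fix \<omega> assume \<omega>: "\<omega> \<in> space M" "t < order_stat n (\<lambda>j. X j \<omega>) l"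
      then have "t < order_stat n (\<lambda>j. X j \<omega>) 2"
        using order_stat_antimono[of 2 l n "\<lambda>j. X j \<omega>"] l by simp
      then obtain i j where "1 \<le> i" "i < j" "j \<le> n" "t < X i \<omega>" "t < X j \<omega>"
        using l by (elim order_stat_2_greaterE[rotated]) auto
      then show "\<omega> \<in> (\<Union>p\<in>?I. ?B t p)" using \<omega> by (intro UN_I[of "(i, j)"]) auto
    qed
    then have "tail M (\<lambda>\<omega>. order_stat n (\<lambda>j. X j \<omega>) l) t \<le> measure M (\<Union>p\<in>?I. ?B t p)"
      using B by (intro finite_measure_mono sets.finite_UN) auto
    also have "\<dots> \<le> (\<Sum>p\<in>?I. measure M (?B t p))"
      using B by (intro measure_UNION_le) auto
    finally show ?thesis
      using pos[of t] by (simp add: divide_right_mono less_imp_le flip: sum_divide_distrib)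
  qed
  have "((\<lambda>t. \<Sum>p\<in>?I. measure M (?B t p) / F t) \<longlongrightarrow> (\<Sum>p\<in>?I. 0)) at_top"
    by (intro tendsto_sum pair) auto
  then have ub: "((\<lambda>t. \<Sum>p\<in>?I. measure M (?B t p) / F t) \<longlongrightarrow> 0) at_top" by simp
  show ?thesis
    by (rule tendsto_sandwich[OF _ _ tendsto_const ub])
      (use le pos in \<open>auto intro!: always_eventually divide_nonneg_pos\<close>)
qed

end

section \<open>The randomly weighted sum of order statistics\<close>

theorem theorem2:
  fixes M :: "'a measure"
    and X C :: "nat \<Rightarrow> 'a \<Rightarrow> real"
    and lam :: "nat \<Rightarrow> real"
    and n k :: nat
    and \<alpha> \<beta> \<gamma> :: real
  assumes ps: "prob_space M"
    and n: "n \<ge> 1" and k: "1 \<le> k" "k \<le> n"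
    and X_meas: "\<And>i. i \<in> {1..n} \<Longrightarrow> X i \<in> borel_measurable M"
    and X_pos: "\<And>i \<omega>. i \<in> {1..n} \<Longrightarrow> \<omega> \<in> space M \<Longrightarrow> X i \<omega> > 0"
    and C_meas: "\<And>i. i \<in> {1..n} \<Longrightarrow> C i \<in> borel_measurable M"
    and C1_pos: "\<And>\<omega>. \<omega> \<in> space M \<Longrightarrow> C 1 \<omega> > 0"
    and indep: "prob_space.indep_var M
                  (PiM {1..n} (\<lambda>_. borel)) (\<lambda>\<omega>. \<lambda>i\<in>{1..n}. X i \<omega>)
                  (PiM {1..n} (\<lambda>_. borel)) (\<lambda>\<omega>. \<lambda>i\<in>{1..n}. C i \<omega>)"
    and lam_nonneg: "\<And>i. i \<in> {1..n} \<Longrightarrow> lam i \<ge> 0"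
    and lam_lim: "\<And>i. i \<in> {1..n} \<Longrightarrow>
       ((\<lambda>t. measure M {\<omega> \<in> space M. X i \<omega> > t} / measure M {\<omega> \<in> space M. X 1 \<omega> > t})
          \<longlongrightarrow> lam i) at_top"
    and regvar: "\<And>x. x > 0 \<Longrightarrow>
       ((\<lambda>t. measure M {\<omega> \<in> space M. X 1 \<omega> > t * x} / measure M {\<omega> \<in> space M. X 1 \<omega> > t})
          \<longlongrightarrow> x powr (-\<alpha>)) at_top"
    and alpha: "\<alpha> \<ge> 0"
    and beta: "\<beta> > \<alpha>" "integrable M (\<lambda>\<omega>. C 1 \<omega> powr \<beta>)"
    and asym_indep: "((\<lambda>t. Max (insert 0
          {measure M {\<omega> \<in> space M. X i \<omega> > t \<and> X j \<omega> > t} / measure M {\<omega> \<in> space M. X 1 \<omega> > t}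
           | i j. 1 \<le> i \<and> i < j \<and> j \<le> n})) \<longlongrightarrow> 0) at_top"
    and gamma: "\<gamma> > \<alpha>"
    and gamma_mom: "n \<ge> 2 \<longrightarrow>
       (integrable M (\<lambda>\<omega>. Max ((\<lambda>i. \<bar>C i \<omega>\<bar> powr \<gamma>) ` {2..n})) \<and>
        (\<integral>\<omega>. Max ((\<lambda>i. \<bar>C i \<omega>\<bar> powr \<gamma>) ` {2..n}) \<partial>M) > 0)"
  defines "L \<equiv> (\<lambda>\<omega>. \<Sum>i=1..k. C i \<omega> * order_stat n (\<lambda>j. X j \<omega>) i)"
  shows "(((\<lambda>t. measure M {\<omega> \<in> space M. L \<omega> > t}
              / measure M {\<omega> \<in> space M. C 1 \<omega> * order_stat n (\<lambda>j. X j \<omega>) 1 > t}) \<longlongrightarrow> 1) at_top)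
    \<and> (((\<lambda>t. measure M {\<omega> \<in> space M. C 1 \<omega> * order_stat n (\<lambda>j. X j \<omega>) 1 > t}
              / (measure M {\<omega> \<in> space M. X 1 \<omega> > t} * (\<integral>\<omega>. C 1 \<omega> powr \<alpha> \<partial>M) * (\<Sum>i=1..n. lam i)))
           \<longlongrightarrow> 1) at_top)
    \<and> (((\<lambda>t. measure M {\<omega> \<in> space M. L \<omega> > t}
              / (\<Sum>i=1..n. measure M {\<omega> \<in> space M. C i \<omega> * order_stat n (\<lambda>j. X j \<omega>) i > t}))
           \<longlongrightarrow> 1) at_top)"
proof -
  interpret prob_space M by (rule ps)
  let ?F = "tail M (X 1)"
  let ?O = "\<lambda>i \<omega>. order_stat n (\<lambda>j. X j \<omega>) i"
  have one: "1 \<in> {1..n}" using n by simp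
  note [measurable] = X_meas[OF one] C_meas[OF one]
  have F_anti: "antimono ?F" by (rule antimono_tail) measurable
  have F_pos: "0 < ?F t" for t
  proof -
    \<comment> \<open>Division by zero gives \<open>0\<close>, so a limit \<open>1\<close> for
      \<open>x = 1\<close> forces positive tails at arbitrarily large \<open>s\<close>; monotonicity
      carries this down to every \<open>t\<close>.\<close>
    have "((\<lambda>t. ?F t / ?F t) \<longlongrightarrow> 1) at_top" using regvar[of 1] by simp
    then have "\<forall>\<^sub>F s in at_top. 0 < ?F s / ?F s" by (rule order_tendstoD(1)) simp
    then have "\<forall>\<^sub>F s in at_top. 0 < ?F s / ?F s \<and> t \<le> s"
      using eventually_ge_at_top[of t] by eventually_elim simp
    then obtain s where s: "0 < ?F s / ?F s" "t \<le> s"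
      using eventually_happens[of _ at_top] by fastforce
    have "0 < ?F s" using s(1) by (cases "?F s = 0") (auto simp: zero_less_measure_iff)
    also have "\<dots> \<le> ?F t" by (rule antimonoD[OF F_anti s(2)])
    finally show ?thesis .
  qed
  interpret regularly_varying_tail ?F \<alpha>
    by unfold_locales (use F_anti F_pos alpha regvar in auto)

  let ?q = "\<lambda>i j t. measure M {\<omega> \<in> space M. t < X i \<omega> \<and> t < X j \<omega>}"
  \<comment> \<open>Each ratio lies between \<open>0\<close> and the maximum in
    \<open>asym_indep\<close>, which is taken over a finite set.\<close>
  have pair_less: "((\<lambda>t. ?q i j t / ?F t) \<longlongrightarrow> 0) at_top" if ij: "1 \<le> i" "i < j" "j \<le> n" for i j
  proof (rule tendsto_sandwich[OF _ _ tendsto_const asym_indep])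
    show "\<forall>\<^sub>F t in at_top. ?q i j t / ?F t \<le> Max (insert 0 {?q i j t / ?F t | i j. 1 \<le> i \<and> i < j \<and> j \<le> n})"
    proof (rule always_eventually, rule allI, rule Max_ge)
      fix t
      have "{?q i j t / ?F t | i j. 1 \<le> i \<and> i < j \<and> j \<le> n}
          \<subseteq> (\<lambda>(i, j). ?q i j t / ?F t) ` ({1..n} \<times> {1..n})"
        by force
      then show "finite (insert 0 {?q i j t / ?F t | i j. 1 \<le> i \<and> i < j \<and> j \<le> n})"
        using finite_subset by fastforce
      show "?q i j t / ?F t \<in> insert 0 {?q i j t / ?F t | i j. 1 \<le> i \<and> i < j \<and> j \<le> n}"
        using ij by blast
    qed
  qed auto
  have pair: "((\<lambda>t. ?q i j t / ?F t) \<longlongrightarrow> 0) at_top" if "i \<in> {1..n}" "j \<in> {1..n}" "i \<noteq> j" for i j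
    using that pair_less[of i j] pair_less[of j i]
    by (cases i j rule: linorder_cases) (auto simp: conj_commute)

  have O_meas: "?O i \<in> borel_measurable M" if "i \<in> {1..n}" for i
    using that X_meas by (intro borel_measurable_order_stat) auto
  have O_pos: "0 < ?O i \<omega>" if "i \<in> {1..n}" "\<omega> \<in> space M" for i \<omega>
    using that X_pos by (intro order_stat_pos) auto

  define E where "E = (\<integral>\<omega>. C 1 \<omega> powr \<alpha> \<partial>M)"
  define c where "c = (\<Sum>i=1..n. lam i) * E"
  have "((\<lambda>t. tail M (\<lambda>\<omega>. C 1 \<omega> * ?O 1 \<omega>) t / ?F t)
      \<longlongrightarrow> (\<Sum>i=1..n. lam i) * (\<integral>\<omega>. (if 0 < C 1 \<omega> then C 1 \<omega> powr \<alpha> else 0) \<partial>M)) at_top"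
    using indep_var_order_stat_component[OF indep one one, of "\<lambda>x. x"]
    by (intro Breiman[OF ps _ O_pos tail_order_stat_1 beta] n X_meas lam_lim pair ps one) auto
  \<comment> \<open>Positivity of \<open>C 1\<close> removes the case distinction left by Breiman's
    lemma.\<close>
  also have "(\<integral>\<omega>. (if 0 < C 1 \<omega> then C 1 \<omega> powr \<alpha> else 0) \<partial>M) = E"
    unfolding E_def using C1_pos by (intro Bochner_Integration.integral_cong) auto
  finally have lead: "((\<lambda>t. tail M (\<lambda>\<omega>. C 1 \<omega> * ?O 1 \<omega>) t / ?F t) \<longlongrightarrow> c) at_top"
    unfolding c_def .

  have neg: "((\<lambda>t. tail M (\<lambda>\<omega>. \<bar>C i \<omega>\<bar> * ?O i \<omega>) t / ?F t) \<longlongrightarrow> 0) at_top" if i: "i \<in> {2..n}" for i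
  proof -
    have i': "i \<in> {1..n}" using i by simp
    note [measurable] = C_meas[OF i']
    have "integrable M (\<lambda>\<omega>. \<bar>C i \<omega>\<bar> powr \<gamma>)"
    proof (rule Bochner_Integration.integrable_bound)
      show "integrable M (\<lambda>\<omega>. Max ((\<lambda>i. \<bar>C i \<omega>\<bar> powr \<gamma>) ` {2..n}))" using gamma_mom i by simp
      show "AE \<omega> in M. norm (\<bar>C i \<omega>\<bar> powr \<gamma>) \<le> norm (Max ((\<lambda>i. \<bar>C i \<omega>\<bar> powr \<gamma>) ` {2..n}))"
      proof (rule AE_I2)
        fix \<omega>
        have "\<bar>C i \<omega>\<bar> powr \<gamma> \<le> Max ((\<lambda>i. \<bar>C i \<omega>\<bar> powr \<gamma>) ` {2..n})"
          using i by (intro Max_ge) auto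
        then show "norm (\<bar>C i \<omega>\<bar> powr \<gamma>) \<le> norm (Max ((\<lambda>i. \<bar>C i \<omega>\<bar> powr \<gamma>) ` {2..n}))" by simp
      qed
    qed measurable
    \<comment> \<open>Breiman's lemma with limit constant \<open>0\<close>: a weight with a moment
      of order \<open>\<gamma>\<close> cannot make a negligible tail relevant.\<close>
    then have "((\<lambda>t. tail M (\<lambda>\<omega>. \<bar>C i \<omega>\<bar> * ?O i \<omega>) t / ?F t)
        \<longlongrightarrow> 0 * (\<integral>\<omega>. (if 0 < \<bar>C i \<omega>\<bar> then \<bar>C i \<omega>\<bar> powr \<alpha> else 0) \<partial>M)) at_top"
      using indep_var_order_stat_component[OF indep i' i', of abs]
      by (intro Breiman[OF ps _ O_pos tail_order_stat_negligible gamma] X_meas pair ps i i') auto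
    then show ?thesis by simp
  qed

  have CO_meas: "(\<lambda>\<omega>. C i \<omega> * ?O i \<omega>) \<in> borel_measurable M" if "i \<in> {1..n}" for i
    using that by (intro borel_measurable_times C_meas O_meas)
  have abs_meas: "(\<lambda>\<omega>. \<bar>C i \<omega>\<bar> * ?O i \<omega>) \<in> borel_measurable M" if "i \<in> {1..n}" for i
    using that by (intro borel_measurable_times borel_measurable_abs C_meas O_meas)

  have L_lim: "((\<lambda>t. tail M L t / ?F t) \<longlongrightarrow> c) at_top"
  \<comment> \<open>The leading term plays \<open>U\<close>, and the remaining terms in absolute
    value play \<open>R\<close>, since weights other than \<open>C 1\<close> may be
    negative.\<close>
  proof (rule tail_perturbation[OF ps _ _ _ _ lead])
    show "((\<lambda>t. tail M (\<lambda>\<omega>. \<Sum>i=2..k. \<bar>C i \<omega>\<bar> * ?O i \<omega>) t / ?F t) \<longlongrightarrow> 0) at_top"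
      using k by (intro tail_sum_negligible ps neg abs_meas) auto
    show "L \<in> borel_measurable M"
      unfolding L_def using k by (intro borel_measurable_sum CO_meas) auto
    show "(\<lambda>\<omega>. \<Sum>i=2..k. \<bar>C i \<omega>\<bar> * ?O i \<omega>) \<in> borel_measurable M"
      using k by (intro borel_measurable_sum abs_meas) auto
    show "(\<lambda>\<omega>. C 1 \<omega> * ?O 1 \<omega>) \<in> borel_measurable M" by (rule CO_meas[OF one])
    fix \<omega> assume \<omega>: "\<omega> \<in> space M"
    have "L \<omega> - C 1 \<omega> * ?O 1 \<omega> = (\<Sum>i=2..k. C i \<omega> * ?O i \<omega>)"
      unfolding L_def using k by (simp add: sum.atLeast_Suc_atMost numeral_2_eq_2)
    also have "\<bar>\<dots>\<bar> \<le> (\<Sum>i=2..k. \<bar>C i \<omega> * ?O i \<omega>\<bar>)" by (rule sum_abs)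
    also have "\<dots> = (\<Sum>i=2..k. \<bar>C i \<omega>\<bar> * ?O i \<omega>)"
      using k O_pos[OF _ \<omega>] by (intro sum.cong refl) (simp add: abs_mult abs_of_pos)
    finally show "\<bar>L \<omega> - C 1 \<omega> * ?O 1 \<omega>\<bar> \<le> (\<Sum>i=2..k. \<bar>C i \<omega>\<bar> * ?O i \<omega>)" .
  qed

  have neg': "((\<lambda>t. tail M (\<lambda>\<omega>. C i \<omega> * ?O i \<omega>) t / ?F t) \<longlongrightarrow> 0) at_top" if i: "i \<in> {2..n}" for i
  proof (rule tendsto_sandwich[OF _ _ tendsto_const neg[OF i]])
    have i': "i \<in> {1..n}" using i by simp
    have "tail M (\<lambda>\<omega>. C i \<omega> * ?O i \<omega>) t \<le> tail M (\<lambda>\<omega>. \<bar>C i \<omega>\<bar> * ?O i \<omega>) t" for t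
    proof (rule finite_measure_mono)
      show "{\<omega> \<in> space M. t < C i \<omega> * ?O i \<omega>} \<subseteq> {\<omega> \<in> space M. t < \<bar>C i \<omega>\<bar> * ?O i \<omega>}"
      proof safe
        fix \<omega> assume "\<omega> \<in> space M" "t < C i \<omega> * ?O i \<omega>"
        moreover have "C i \<omega> * ?O i \<omega> \<le> \<bar>C i \<omega>\<bar> * ?O i \<omega>"
          using O_pos[OF i' \<open>\<omega> \<in> space M\<close>] by (intro mult_right_mono) auto
        ultimately show "t < \<bar>C i \<omega>\<bar> * ?O i \<omega>" by linarith
      qed
      show "{\<omega> \<in> space M. t < \<bar>C i \<omega>\<bar> * ?O i \<omega>} \<in> sets M"
        using abs_meas[OF i'] by measurable
    qed
    then show "\<forall>\<^sub>F t in at_top. tail M (\<lambda>\<omega>. C i \<omega> * ?O i \<omega>) t / ?F t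
        \<le> tail M (\<lambda>\<omega>. \<bar>C i \<omega>\<bar> * ?O i \<omega>) t / ?F t"
      by (intro always_eventually allI divide_right_mono) auto
  qed auto
  have "((\<lambda>t. tail M (\<lambda>\<omega>. C 1 \<omega> * ?O 1 \<omega>) t / ?F t + (\<Sum>i=2..n. tail M (\<lambda>\<omega>. C i \<omega> * ?O i \<omega>) t / ?F t))
      \<longlongrightarrow> c + (\<Sum>i=2..n. 0)) at_top"
    by (intro tendsto_add lead tendsto_sum neg')
  moreover have "(\<Sum>i=1..n. tail M (\<lambda>\<omega>. C i \<omega> * ?O i \<omega>) t) / ?F t
      = tail M (\<lambda>\<omega>. C 1 \<omega> * ?O 1 \<omega>) t / ?F t + (\<Sum>i=2..n. tail M (\<lambda>\<omega>. C i \<omega> * ?O i \<omega>) t / ?F t)" for t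
    using n by (simp add: sum.atLeast_Suc_atMost numeral_2_eq_2 add_divide_distrib sum_divide_distrib)
  ultimately have sum_lim: "((\<lambda>t. (\<Sum>i=1..n. tail M (\<lambda>\<omega>. C i \<omega> * ?O i \<omega>) t) / ?F t) \<longlongrightarrow> c) at_top"
    by simp

  have E_pos: "0 < E"
  proof -
    \<comment> \<open>Integrability must come first, as the integral of a non-integrable function is
      \<open>0\<close> by convention. The bound \<open>1 + C 1 \<omega> powr \<beta>\<close> follows
      by separating \<open>C 1 \<omega> \<le> 1\<close> from larger values.\<close>
    have int: "integrable M (\<lambda>\<omega>. C 1 \<omega> powr \<alpha>)"
    proof (rule Bochner_Integration.integrable_bound)
      show "integrable M (\<lambda>\<omega>. 1 + C 1 \<omega> powr \<beta>)" using beta by simp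
      show "AE \<omega> in M. norm (C 1 \<omega> powr \<alpha>) \<le> norm (1 + C 1 \<omega> powr \<beta>)"
      proof (rule AE_I2)
        fix \<omega> assume "\<omega> \<in> space M"
        then have "0 < C 1 \<omega>" by (rule C1_pos)
        then have "C 1 \<omega> powr \<alpha> \<le> 1 + C 1 \<omega> powr \<beta>"
          using alpha beta powr_mono[of \<alpha> \<beta> "C 1 \<omega>"] powr_le1[of \<alpha> "C 1 \<omega>"]
          by (cases "C 1 \<omega> \<le> 1") (auto intro: add_increasing add_increasing2)
        then show "norm (C 1 \<omega> powr \<alpha>) \<le> norm (1 + C 1 \<omega> powr \<beta>)" by simp
      qed
    qed measurable
    have "(\<integral>\<omega>. 0 \<partial>M) < E"
      unfolding E_def using int C1_pos
      by (intro integral_less_AE_space) (auto simp: emeasure_space_1 less_imp_neq[symmetric] intro!: AE_I2)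
    then show ?thesis by simp
  qed
  \<comment> \<open>Guarantees that the sum of the \<open>lam i\<close> is at least
    \<open>1\<close>, so that \<open>c\<close> is positive and may be divided by.\<close>
  have lam1: "lam 1 = 1"
  proof (rule tendsto_unique[OF _ lam_lim[OF one]])
    show "((\<lambda>t. ?F t / ?F t) \<longlongrightarrow> 1) at_top" using regvar[of 1] by simp
  qed simp
  have "lam 1 \<le> (\<Sum>i=1..n. lam i)"
    using one lam_nonneg by (intro member_le_sum) auto
  then have c: "0 < c" unfolding c_def using lam1 E_pos by (intro mult_pos_pos) auto
  \<comment> \<open>Two functions with the same positive limit \<open>c\<close> relative to
    \<open>?F\<close> are asymptotically equal; all three claims are instances.\<close>
  have quot: "((\<lambda>t. a t / b t) \<longlongrightarrow> 1) at_top"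
    if "((\<lambda>t. a t / ?F t) \<longlongrightarrow> c) at_top" "((\<lambda>t. b t / ?F t) \<longlongrightarrow> c) at_top" for a b
    using tendsto_divide[OF that] c F_pos by (simp add: less_imp_neq[symmetric])
  have const: "((\<lambda>t. ?F t * E * (\<Sum>i=1..n. lam i) / ?F t) \<longlongrightarrow> c) at_top"
    using F_pos by (simp add: less_imp_neq[symmetric] c_def mult.commute)
  show ?thesis
    using quot[OF L_lim lead] quot[OF lead const] quot[OF L_lim sum_lim] unfolding E_def by blast
qed

end
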